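(* Let $V$ be a finite-dimensional real vector space with norm $\|\cdot\|$, dual space $V^*$ and dual norm $\|\cdot\|_*$. Let $K\subseteq V$ be a non-empty closed convex set (bounded or unbounded) with diameter $D=\sup_{u,v\in K}\|u-v\|\in[0,+\infty]$. Let $\lambda>0$ and let $R:K\to\mathbb{R}$ be a non-negative lower semi-continuous function that is $\lambda$-strongly convex with respect to $\|\cdot\|$. Then for every sequence of loss vectors $\ell_1,\ell_2,\dots\in V^*$, every integer $T\ge1$ and every $u\in K$, the regret of the SOLO FTRL algorithm with regularizer $R$ satisfies $$\mathrm{Regret}_T(u)\le\left(R(u)+\frac{2.75}{\lambda}\right)\sqrt{\sum_{t=1}^T\|\ell_t\|_*^2}+3.5\,\min\left\{\frac{\sqrt{T-1}}{\lambda},D\right\}\max_{1\le t\le T}\|\ell_t\|_*.$$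
   Context: Online linear optimization: in each round $t=1,2,\dots$ an algorithm chooses $w_t\in K$ (depending only on $\ell_1,\dots,\ell_{t-1}$), then observes $\ell_t\in V^*$. For $u\in K$, $\mathrm{Regret}_T(u)=\sum_{t=1}^T\langle \ell_t,w_t\rangle-\sum_{t=1}^T\langle \ell_t,u\rangle$, where $\langle\cdot,\cdot\rangle:V^*\times V\to\mathbb{R}$ is the duality pairing. Strong convexity: a convex function $f:K\to\mathbb{R}$ is $\lambda$-strongly convex with respect to $\|\cdot\|$ if $f(y)\ge f(x)+\langle g,y-x\rangle+\frac{\lambda}{2}\|x-y\|^2$ for all $x,y\in K$ and every subgradient $g\in V^*$ of $f$ at $x$. SOLO FTRL with regularizer $R$: let $L_t=\sum_{s=1}^t\ell_s$ (so $L_0=0$). In round $t$ the algorithm predicts $$w_t=\arg\min_{w\in K}\left(\langle L_{t-1},w\rangle+R(w)\sqrt{\sum_{s=1}^{t-1}\|\ell_s\|_*^2}\right).$$ When $\sum_{s=1}^{t-1}\|\ell_s\|_*^2=0$ (in particular for $t=1$), ties are broken by the smallest value of $R$, i.e. $w_t=\arg\min_{w\in K}R(w)$. *)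

theory Defs
  imports "HOL-Analysis.Analysis"
begin

text \<open>
  Over a finite-dimensional real normed space \<open>'a\<close> every linear functional is bounded, so the dual
  space is \<open>'a \<Rightarrow>\<^sub>L real\<close>, application is the duality pairing, and its norm (the operator norm) is
  the dual norm.  A function \<open>K \<rightarrow> \<real>\<close> is given as a total function of which only the values
  on \<open>K\<close> matter.
\<close>

definition lower_semicontinuous_on :: "'a::topological_space set \<Rightarrow> ('a \<Rightarrow> real) \<Rightarrow> bool" where
  "lower_semicontinuous_on K f \<longleftrightarrow>
     (\<forall>x\<in>K. \<forall>c < f x. eventually (\<lambda>y. c < f y) (at x within K))"

definition subgradients ::
  "'a::real_normed_vector set \<Rightarrow> ('a \<Rightarrow> real) \<Rightarrow> 'a \<Rightarrow> ('a \<Rightarrow>\<^sub>L real) set" where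
  "subgradients K f x = {g. \<forall>y\<in>K. f y \<ge> f x + blinfun_apply g (y - x)}"

definition strongly_convex_on ::
  "real \<Rightarrow> 'a::real_normed_vector set \<Rightarrow> ('a \<Rightarrow> real) \<Rightarrow> bool" where
  "strongly_convex_on lam K f \<longleftrightarrow> convex_on K f \<and>
     (\<forall>x\<in>K. \<forall>y\<in>K. \<forall>g\<in>subgradients K f x.
        f y \<ge> f x + blinfun_apply g (y - x) + lam / 2 * (norm (x - y))\<^sup>2)"

text \<open>The library's \<^const>\<open>diameter\<close> is real-valued, hence unsuitable for unbounded sets.\<close>

definition ediameter :: "'a::real_normed_vector set \<Rightarrow> ereal" where
  "ediameter K = (SUP (u, v)\<in>K \<times> K. ereal (norm (u - v)))"

text \<open>
  Rounds are numbered from 1; the value of a loss sequence at index 0 is never used.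
\<close>

definition cumulative_loss ::
  "(nat \<Rightarrow> ('a::real_normed_vector \<Rightarrow>\<^sub>L real)) \<Rightarrow> nat \<Rightarrow> ('a \<Rightarrow>\<^sub>L real)" where
  "cumulative_loss \<l> t = (\<Sum>s=1..t. \<l> s)"

definition sum_sq_norms :: "(nat \<Rightarrow> ('a::real_normed_vector \<Rightarrow>\<^sub>L real)) \<Rightarrow> nat \<Rightarrow> real" where
  "sum_sq_norms \<l> t = (\<Sum>s=1..t. (norm (\<l> s))\<^sup>2)"

text \<open>
  \<^const>\<open>arg_min_on\<close> chooses some minimizer over \<open>K\<close>.  For a lower semicontinuous strongly convex
  \<open>R\<close> with positive modulus on a non-empty closed set \<open>K\<close> in finite dimension, the minimizer below
  exists and is unique.  The first branch is the tie-breaking rule: there the scaled objective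
  vanishes identically.
\<close>

definition solo_ftrl ::
  "'a::real_normed_vector set \<Rightarrow> ('a \<Rightarrow> real) \<Rightarrow> (nat \<Rightarrow> ('a \<Rightarrow>\<^sub>L real)) \<Rightarrow> nat \<Rightarrow> 'a" where
  "solo_ftrl K R \<l> t =
     (if sum_sq_norms \<l> (t - 1) = 0 then arg_min_on R K
      else arg_min_on
        (\<lambda>w. blinfun_apply (cumulative_loss \<l> (t - 1)) w + R w * sqrt (sum_sq_norms \<l> (t - 1))) K)"

definition regret ::
  "(nat \<Rightarrow> ('a::real_normed_vector \<Rightarrow>\<^sub>L real)) \<Rightarrow> (nat \<Rightarrow> 'a) \<Rightarrow> nat \<Rightarrow> 'a \<Rightarrow> real" where
  "regret \<l> w T u =
     (\<Sum>t=1..T. blinfun_apply (\<l> t) (w t)) - (\<Sum>t=1..T. blinfun_apply (\<l> t) u)"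

end

theory Submission
  imports Defs
begin

text \<open>With \<open>S\<^sub>t\<^sup>2 = \<parallel>\<l>\<^sub>1\<parallel>\<^sup>2 + \<dots> + \<parallel>\<l>\<^sub>t\<parallel>\<^sup>2\<close> and \<open>F\<^sub>t\<close> the objective minimized in round \<open>t\<close>, the regret
  telescopes to at most \<open>S\<^sub>T R(u)\<close> plus the gaps \<open>F\<^sub>t(w\<^sub>t) + \<l>\<^sub>t(w\<^sub>t) - F\<^sub>t\<^sub>+\<^sub>1(w\<^sub>t\<^sub>+\<^sub>1)\<close>.  Strong convexity
  bounds a gap by \<open>\<parallel>\<l>\<^sub>t\<parallel>\<^sup>2 / (2\<lambda> S\<^sub>t\<^sub>-\<^sub>1)\<close>, which is \<open>O((S\<^sub>t - S\<^sub>t\<^sub>-\<^sub>1)/\<lambda>)\<close> as long as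
  \<open>\<parallel>\<l>\<^sub>t\<parallel> \<le> 2 S\<^sub>t\<^sub>-\<^sub>1\<close>.  Otherwise the gap is at most \<open>\<parallel>\<l>\<^sub>t\<parallel> \<parallel>w\<^sub>t - w\<^sub>t\<^sub>+\<^sub>1\<parallel>\<close>, and the distance is bounded by
  the diameter or, as \<open>w\<^sub>t\<close> is a \<open>1/\<lambda>\<close>-Lipschitz function of \<open>-L\<^sub>t\<^sub>-\<^sub>1/S\<^sub>t\<^sub>-\<^sub>1\<close> and
  \<open>\<parallel>L\<^sub>t\<^sub>-\<^sub>1\<parallel> \<le> \<surd>(t-1) S\<^sub>t\<^sub>-\<^sub>1\<close> by Cauchy-Schwarz, by \<open>(\<surd>(t-1) + \<parallel>\<l>\<^sub>t\<parallel>/S\<^sub>t)/\<lambda>\<close>.  The large losses grow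
  geometrically, so their norms sum to at most twice the maximum.\<close>

section \<open>Compactness in finite-dimensional normed spaces\<close>

text \<open>By homogeneity only coefficients of maximum modulus 1 matter. They form a compact set on
  which the norm is continuous and, by independence, nowhere zero; \<open>m\<close> is its minimum
  there.\<close>

lemma independent_norm_lower_bound:
  fixes B :: "'a::real_normed_vector set"
  assumes fin: "finite B" and ind: "independent B"
  obtains m where "m > 0" "\<And>c b. b \<in> B \<Longrightarrow> m * \<bar>c b\<bar> \<le> norm (\<Sum>b\<in>B. c b *\<^sub>R b)"
proof (cases "B = {}")
  case True
  then show ?thesis using that[of 1] by simp
next
  case False
  \<comment> \<open>Coefficients are fixed to 0 outside \<open>B\<close>, so that the cube is a
    product over the whole type and Tychonoff's theorem applies. \<open>Q\<close> keeps the
    coefficients of maximum modulus 1.\<close>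
  define P where "P = PiE (UNIV::'a set) (\<lambda>b. if b \<in> B then {-1..1::real} else {0})"
  define Q where "Q = P \<inter> (\<Union>b\<in>B. {c. \<bar>c b\<bar> = 1})"
  define N where "N = (\<lambda>c::'a \<Rightarrow> real. norm (\<Sum>b\<in>B. c b *\<^sub>R b))"
  have "compactin (product_topology (\<lambda>_. euclidean) UNIV) P"
    unfolding P_def compactin_PiE by simp
  then have "compact P"
    by (simp add: euclidean_product_topology)
  moreover have "closed (\<Union>b\<in>B. {c::'a \<Rightarrow> real. \<bar>c b\<bar> = 1})"
    by (intro closed_UN fin ballI closed_Collect_eq continuous_intros continuous_on_product_coordinates)
  ultimately have "compact Q"
    unfolding Q_def by (rule compact_Int_closed)
  have contN: "continuous_on Q N"
    unfolding N_def
    by (intro continuous_intros continuous_on_subset[OF continuous_on_product_coordinates]) auto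
  obtain b0 where b0: "b0 \<in> B" using False by blast
  have "(\<lambda>b. if b = b0 then 1 else 0) \<in> Q"
    unfolding Q_def P_def using b0 by auto
  then have "Q \<noteq> {}" by blast
  then obtain c0 where c0: "c0 \<in> Q" "\<And>c. c \<in> Q \<Longrightarrow> N c0 \<le> N c"
    using continuous_attains_inf[OF \<open>compact Q\<close> _ contN] by blast
  obtain b1 where b1: "b1 \<in> B" "\<bar>c0 b1\<bar> = 1"
    using c0(1) unfolding Q_def by blast
  have pos: "N c0 > 0"
  proof (rule ccontr)
    assume "\<not> N c0 > 0"
    then have "(\<Sum>b\<in>B. c0 b *\<^sub>R b) = 0"
      unfolding N_def by simp
    from real_vector.independentD[OF ind fin subset_refl this b1(1)] b1(2) show False by simp
  qed
  show ?thesis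
  proof (rule that[OF pos])
    fix c :: "'a \<Rightarrow> real" and b assume b: "b \<in> B"
    define M where "M = Max ((\<lambda>b. \<bar>c b\<bar>) ` B)"
    have cM: "\<bar>c b\<bar> \<le> M" if "b \<in> B" for b
      unfolding M_def using fin that by simp
    obtain b2 where b2: "b2 \<in> B" "M = \<bar>c b2\<bar>"
      using Max_in[of "(\<lambda>b. \<bar>c b\<bar>) ` B"] fin False unfolding M_def
      by (metis finite_imageI imageE image_is_empty)
    show "N c0 * \<bar>c b\<bar> \<le> norm (\<Sum>b\<in>B. c b *\<^sub>R b)"
    proof (cases "M = 0")
      case True
      then show ?thesis using cM[OF b] by simp
    next
      case False
      then have Mpos: "M > 0" using b2 by simp
      define c' where "c' = (\<lambda>b. if b \<in> B then c b / M else 0)"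
      have "c' \<in> Q"
      proof -
        have "\<bar>c' b2\<bar> = 1" using b2 False by (simp add: c'_def)
        moreover have "c' b \<in> {-1..1}" if "b \<in> B" for b
          using cM[OF that] Mpos that by (auto simp: c'_def field_simps abs_le_iff)
        then have "c' \<in> P" unfolding P_def by (auto simp: c'_def)
        ultimately show ?thesis unfolding Q_def using b2(1) by blast
      qed
      then have "N c0 \<le> N c'" by (rule c0(2))
      also have "(\<Sum>b\<in>B. c' b *\<^sub>R b) = (1 / M) *\<^sub>R (\<Sum>b\<in>B. c b *\<^sub>R b)"
        unfolding scaleR_sum_right by (intro sum.cong) (auto simp: c'_def)
      then have "N c' = norm (\<Sum>b\<in>B. c b *\<^sub>R b) / M"
        unfolding N_def using Mpos by simp
      finally have "N c0 * M \<le> norm (\<Sum>b\<in>B. c b *\<^sub>R b)"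
        using Mpos by (simp add: field_simps)
      moreover have "N c0 * \<bar>c b\<bar> \<le> N c0 * M"
        using cM[OF b] pos by simp
      ultimately show ?thesis by linarith
    qed
  qed
qed

text \<open>The lower bound on the norms of combinations of a basis says precisely that the
  coordinate functionals are bounded, with constant \<open>1 / m\<close>.\<close>

lemma finite_dimensional_bounded_coordinates:
  assumes "\<exists>B :: 'a::real_normed_vector set. finite_dimensional_vector_space (*\<^sub>R) B"
  obtains B :: "'a::real_normed_vector set" and c :: "'a \<Rightarrow> 'a \<Rightarrow> real"
  where "finite B" "\<And>b. b \<in> B \<Longrightarrow> bounded_linear (c b)" "\<And>x. (\<Sum>b\<in>B. c b x *\<^sub>R b) = x"
proof -
  from assms obtain B :: "'a set" where "finite_dimensional_vector_space (*\<^sub>R) B" by blast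
  then interpret fd: finite_dimensional_vector_space "(*\<^sub>R)" B .
  have fin: "finite B" by (rule fd.finite_Basis)
  have ind: "independent B" using fd.independent_Basis by (simp add: dependent_raw_def)
  have span: "span B = UNIV" using fd.span_Basis by (simp add: span_raw_def)
  have sum: "(\<Sum>b\<in>B. representation B x b *\<^sub>R b) = x" for x
    using real_vector.sum_representation_eq[OF ind _ fin subset_refl, of x] span by simp
  from independent_norm_lower_bound[OF fin ind] obtain m where m: "m > 0"
    "\<And>c b. b \<in> B \<Longrightarrow> m * \<bar>c b\<bar> \<le> norm (\<Sum>b\<in>B. c b *\<^sub>R b)" by blast
  have "bounded_linear (\<lambda>x. representation B x b)" if "b \<in> B" for b
  proof (rule bounded_linear_intro[where K = "1 / m"])
    show "representation B (x + y) b = representation B x b + representation B y b" for x y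
      using real_vector.representation_add[OF ind] span by simp
    show "representation B (r *\<^sub>R x) b = r *\<^sub>R representation B x b" for r x
      using real_vector.representation_scale[OF ind] span by simp
    show "norm (representation B x b) \<le> norm x * (1 / m)" for x
      using m(2)[OF that, of "representation B x"] m(1) by (simp add: sum field_simps)
  qed
  then show ?thesis using that[OF fin, of "\<lambda>b x. representation B x b"] sum by blast
qed

text \<open>The ball is a closed subset of the continuous image of a compact box of
  coordinates.\<close>

lemma finite_dimensional_compact_cball:
  fixes z :: "'a::real_normed_vector"
  assumes "\<exists>B :: 'a set. finite_dimensional_vector_space (*\<^sub>R) B"
  shows "compact (cball z r)"
proof -
  obtain B :: "'a set" and c :: "'a \<Rightarrow> 'a \<Rightarrow> real"
    where fin: "finite B" and bl: "\<And>b. b \<in> B \<Longrightarrow> bounded_linear (c b)"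
      and sum: "\<And>x. (\<Sum>b\<in>B. c b x *\<^sub>R b) = x"
    using finite_dimensional_bounded_coordinates[OF assms] by blast
  define k where "k = (\<lambda>b. onorm (c b) * (norm z + r))"
  define P where "P = PiE (UNIV::'a set) (\<lambda>b. if b \<in> B then {-k b..k b} else {0})"
  have "compactin (product_topology (\<lambda>_. euclidean) UNIV) P"
    unfolding P_def compactin_PiE by simp
  then have "compact P"
    by (simp add: euclidean_product_topology)
  moreover have "continuous_on P (\<lambda>d. \<Sum>b\<in>B. d b *\<^sub>R b)"
    by (intro continuous_intros continuous_on_subset[OF continuous_on_product_coordinates]) auto
  ultimately have cP: "compact ((\<lambda>d. \<Sum>b\<in>B. d b *\<^sub>R b) ` P)"
    by (rule compact_continuous_image[rotated])
  have sub: "cball z r \<subseteq> (\<lambda>d. \<Sum>b\<in>B. d b *\<^sub>R b) ` P"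
  proof
    fix x assume x: "x \<in> cball z r"
    have nx: "norm x \<le> norm z + r"
      using x norm_triangle_ineq[of z "x - z"] by (simp add: dist_norm norm_minus_commute)
    have "\<bar>c b x\<bar> \<le> k b" if "b \<in> B" for b
    proof -
      have "norm (c b x) \<le> onorm (c b) * norm x" by (rule onorm[OF bl[OF that]])
      also have "\<dots> \<le> k b"
        unfolding k_def using nx onorm_pos_le[OF bl[OF that]] by (rule mult_left_mono)
      finally show ?thesis by simp
    qed
    then have "(\<lambda>b. if b \<in> B then c b x else 0) \<in> P"
      unfolding P_def by (auto simp: abs_le_iff minus_le_iff)
    moreover have "(\<Sum>b\<in>B. (if b \<in> B then c b x else 0) *\<^sub>R b) = x"
      using sum[of x] by simp
    ultimately show "x \<in> (\<lambda>d. \<Sum>b\<in>B. d b *\<^sub>R b) ` P"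
      by (intro image_eqI[where x = "\<lambda>b. if b \<in> B then c b x else 0"]) simp_all
  qed
  show ?thesis
    using compact_Int_closed[OF cP closed_cball[of z r]] unfolding Int_absorb1[OF sub] .
qed

section \<open>Minimizers of lower semicontinuous functions\<close>

lemma lower_semicontinuous_on_subset:
  assumes "lower_semicontinuous_on K f" "C \<subseteq> K"
  shows "lower_semicontinuous_on C f"
  using assms filter_leD[OF at_le[OF assms(2)]]
  unfolding lower_semicontinuous_on_def by blast

lemma lower_semicontinuous_on_add_continuous:
  assumes f: "lower_semicontinuous_on K f" and g: "continuous_on K g"
  shows "lower_semicontinuous_on K (\<lambda>x. f x + g x)"
  unfolding lower_semicontinuous_on_def
proof (intro ballI allI impI)
  fix x c assume x: "x \<in> K" and c: "c < f x + g x"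
  define e where "e = (f x + g x - c) / 2"
  have e: "e > 0" using c by (simp add: e_def)
  have "\<forall>\<^sub>F y in at x within K. f x - e < f y"
    using f x e unfolding lower_semicontinuous_on_def by simp
  moreover have "(g \<longlongrightarrow> g x) (at x within K)"
    using g x by (simp add: continuous_on_def)
  then have "\<forall>\<^sub>F y in at x within K. g x - e < g y"
    by (rule order_tendstoD) (use e in simp)
  ultimately show "\<forall>\<^sub>F y in at x within K. c < f y + g y"
    by eventually_elim (simp add: e_def field_simps)
qed

text \<open>If every \<open>x\<close> had a point \<open>p x\<close> of smaller value, it would have
  a neighbourhood \<open>U x\<close> on which \<open>f\<close> exceeds \<open>f (p x)\<close>. In a
  finite subcover choose \<open>x\<close> with least \<open>f (p x)\<close>: as \<open>p x\<close>
  lies in some \<open>U y\<close>, \<open>f (p y) < f (p x)\<close>, a contradiction.\<close>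

lemma lower_semicontinuous_attains_inf:
  assumes "compact C" "C \<noteq> {}" and f: "lower_semicontinuous_on C f"
  shows "\<exists>x\<in>C. \<forall>y\<in>C. f x \<le> f y"
proof (rule ccontr)
  assume "\<not> ?thesis"
  then have "\<forall>x\<in>C. \<exists>y\<in>C. f y < f x" by (auto simp: not_le)
  then obtain p where p: "\<And>x. x \<in> C \<Longrightarrow> p x \<in> C" "\<And>x. x \<in> C \<Longrightarrow> f (p x) < f x"
    by metis
  have "\<exists>U. open U \<and> x \<in> U \<and> (\<forall>z\<in>U \<inter> C. f (p x) < f z)" if x: "x \<in> C" for x
  proof -
    have "\<forall>\<^sub>F z in at x within C. f (p x) < f z"
      using f p(2)[OF x] x unfolding lower_semicontinuous_on_def by blast
    then obtain U where U: "open U" "x \<in> U" "\<forall>z\<in>U. z \<noteq> x \<longrightarrow> z \<in> C \<longrightarrow> f (p x) < f z"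
      unfolding eventually_at_topological by blast
    have "f (p x) < f z" if "z \<in> U \<inter> C" for z
      using U(3) p(2)[OF x] that by (cases "z = x") auto
    then show ?thesis using U(1,2) by (intro exI[of _ U]) simp
  qed
  then have "\<forall>x\<in>C. \<exists>U. open U \<and> x \<in> U \<and> (\<forall>z\<in>U \<inter> C. f (p x) < f z)" by blast
  from bchoice[OF this] obtain U where
    "\<forall>x\<in>C. open (U x) \<and> x \<in> U x \<and> (\<forall>z\<in>U x \<inter> C. f (p x) < f z)" ..
  then have U: "\<And>x. x \<in> C \<Longrightarrow> open (U x)" "\<And>x. x \<in> C \<Longrightarrow> x \<in> U x"
    "\<And>x z. x \<in> C \<Longrightarrow> z \<in> U x \<Longrightarrow> z \<in> C \<Longrightarrow> f (p x) < f z"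
    by auto
  have cover: "C \<subseteq> (\<Union>x\<in>C. U x)" using U(2) by blast
  obtain X where X: "X \<subseteq> C" "finite X" "C \<subseteq> (\<Union>x\<in>X. U x)"
    by (rule compactE_image[OF \<open>compact C\<close> U(1) cover])
  have "X \<noteq> {}" using X(3) \<open>C \<noteq> {}\<close> by auto
  then obtain x where x: "x \<in> X" "\<And>y. y \<in> X \<Longrightarrow> f (p x) \<le> f (p y)"
    using ex_is_arg_min_if_finite[OF X(2), of "\<lambda>x. f (p x)"]
    unfolding is_arg_min_linorder by blast
  obtain y where y: "y \<in> X" "p x \<in> U y" using X x(1) p(1) by blast
  have "f (p y) < f (p x)" using U(3) X(1) y x(1) p(1) by blast
  with x(2)[OF y(1)] show False by simp
qed

lemma coercive_attains_inf:
  fixes K :: "'a::real_normed_vector set"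
  assumes fd: "\<exists>B :: 'a set. finite_dimensional_vector_space (*\<^sub>R) B"
    and K: "closed K" "x0 \<in> K" and f: "lower_semicontinuous_on K f"
    and coercive: "\<And>x. x \<in> K \<Longrightarrow> f x \<le> f x0 \<Longrightarrow> norm (x - x0) \<le> r"
  shows "\<exists>x\<in>K. \<forall>y\<in>K. f x \<le> f y"
proof -
  define C where "C = cball x0 r \<inter> K"
  have C: "compact C" "x0 \<in> C" "C \<subseteq> K"
    using finite_dimensional_compact_cball[OF fd] K coercive[OF K(2)]
    unfolding C_def by (auto intro: compact_Int_closed)
  then obtain x where x: "x \<in> C" "\<And>y. y \<in> C \<Longrightarrow> f x \<le> f y"
    using lower_semicontinuous_attains_inf[OF C(1) _ lower_semicontinuous_on_subset[OF f C(3)]]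
    by blast
  have "f x \<le> f y" if "y \<in> K" for y
  proof (cases "f y \<le> f x0")
    case True
    then have "y \<in> C" using coercive[OF that] that
      by (simp add: C_def dist_norm norm_minus_commute)
    then show ?thesis by (rule x(2))
  next
    case False
    then show ?thesis using x(2)[OF C(2)] by simp
  qed
  then show ?thesis using x(1) C(3) by blast
qed

text \<open>The strong convexity of \<^const>\<open>strongly_convex_on\<close> is void where there is no subgradient.
  A minimizer of \<open>R\<close> plus the squared Euclidean norm of the coordinates exists because \<open>R\<close> is
  bounded below; as the added square is differentiable, minus its derivative is a subgradient of
  \<open>R\<close> there, so no separation theorem is needed.\<close>

lemma convex_subgradient_exists:
  fixes K :: "'a::real_normed_vector set"
  assumes fd: "\<exists>B :: 'a set. finite_dimensional_vector_space (*\<^sub>R) B"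
    and K: "closed K" "K \<noteq> {}" and conv: "convex_on K R"
    and nonneg: "\<And>x. x \<in> K \<Longrightarrow> 0 \<le> R x" and lsc: "lower_semicontinuous_on K R"
  shows "\<exists>x\<in>K. \<exists>g. g \<in> subgradients K R x"
proof -
  obtain B :: "'a set" and c :: "'a \<Rightarrow> 'a \<Rightarrow> real"
    where fin: "finite B" and bl: "\<And>b. b \<in> B \<Longrightarrow> bounded_linear (c b)"
      and sum: "\<And>x. (\<Sum>b\<in>B. c b x *\<^sub>R b) = x"
    using finite_dimensional_bounded_coordinates[OF fd] by blast
  define q where "q = (\<lambda>x. \<Sum>b\<in>B. (c b x)\<^sup>2)"
  have contq: "continuous_on K q"
    unfolding q_def by (intro continuous_intros linear_continuous_on bl)
  obtain z where z: "z \<in> K" using K(2) by blast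
  \<comment> \<open>As \<open>R\<close> is non-negative, \<open>R z + q z\<close> bounds
    \<open>q\<close>, hence each squared coordinate, on the sublevel set of
    \<open>z\<close>.\<close>
  have "norm (x - z) \<le> (\<Sum>b\<in>B. sqrt (R z + q z) * norm b) + norm z"
    if x: "x \<in> K" and le: "R x + q x \<le> R z + q z" for x
  proof -
    have "\<bar>c b x\<bar> \<le> sqrt (R z + q z)" if "b \<in> B" for b
    proof -
      have "(c b x)\<^sup>2 \<le> q x" unfolding q_def using that fin by (intro member_le_sum) auto
      also have "\<dots> \<le> R z + q z" using le nonneg[OF x] by simp
      finally show ?thesis by (metis real_sqrt_abs real_sqrt_le_iff)
    qed
    then have "norm (\<Sum>b\<in>B. c b x *\<^sub>R b) \<le> (\<Sum>b\<in>B. sqrt (R z + q z) * norm b)"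
      by (intro sum_norm_le) (simp add: mult_right_mono)
    then show ?thesis using norm_triangle_ineq4[of x z] by (simp add: sum)
  qed
  then obtain x where x: "x \<in> K" "\<And>y. y \<in> K \<Longrightarrow> R x + q x \<le> R y + q y"
    using coercive_attains_inf[OF fd K(1) z lower_semicontinuous_on_add_continuous[OF lsc contq]]
    by blast
  \<comment> \<open>\<open>p\<close> is half the derivative of \<open>q\<close> at the minimizer
    \<open>x\<close>.\<close>
  define p where "p = (\<lambda>v. \<Sum>b\<in>B. c b x * c b v)"
  have blp: "bounded_linear (\<lambda>v. - 2 * p v)"
    unfolding p_def
    by (intro bounded_linear_const_mult bounded_linear_sum bounded_linear_const_mult bl)
  have qexp: "q (x + t *\<^sub>R v) = q x + 2 * t * p v + t\<^sup>2 * q v" for t v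
  proof -
    have "(c b (x + t *\<^sub>R v))\<^sup>2 = (c b x)\<^sup>2 + 2 * t * (c b x * c b v) + t\<^sup>2 * (c b v)\<^sup>2"
      if "b \<in> B" for b
      using bl[OF that, THEN bounded_linear.linear]
      by (simp add: linear_add linear_scale power2_eq_square algebra_simps)
    then show ?thesis
      by (simp add: q_def p_def sum.distrib sum_distrib_left)
  qed
  have "R y \<ge> R x - 2 * p (y - x)" if y: "y \<in> K" for y
  proof -
    define v where "v = y - x"
    \<comment> \<open>Minimality of \<open>x\<close> is tested on the segment towards
      \<open>y\<close> and divided by \<open>t\<close>; the limit for \<open>t\<close> to 0 then
      removes the quadratic term.\<close>
    have step: "0 \<le> R y - R x + 2 * p v + t * q v" if t: "0 < t" "t < 1" for t
    proof -
      have eq: "x + t *\<^sub>R v = (1 - t) *\<^sub>R x + t *\<^sub>R y"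
        by (simp add: v_def algebra_simps)
      have "x + t *\<^sub>R v \<in> K"
        unfolding eq using convex_on_imp_convex[OF conv] x(1) y t by (simp add: convex_def)
      from x(2)[OF this] have "R x + q x \<le> R (x + t *\<^sub>R v) + q (x + t *\<^sub>R v)" .
      moreover have "R (x + t *\<^sub>R v) \<le> (1 - t) * R x + t * R y"
        unfolding eq using convex_onD[OF conv] x(1) y t by simp
      ultimately have "0 \<le> t * (R y - R x + 2 * p v + t * q v)"
        by (simp add: qexp algebra_simps power2_eq_square)
      then show ?thesis using t by (simp add: zero_le_mult_iff)
    qed
    have "0 \<le> R y - R x + 2 * p v + 0 * q v"
    proof (rule tendsto_lowerbound)
      show "((\<lambda>t. R y - R x + 2 * p v + t * q v) \<longlongrightarrow> R y - R x + 2 * p v + 0 * q v) (at_right 0)"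
        by (intro tendsto_intros)
      show "\<forall>\<^sub>F t in at_right 0. 0 \<le> R y - R x + 2 * p v + t * q v"
        using step unfolding eventually_at_right_field by (auto intro: exI[of _ 1])
    qed simp
    then show ?thesis by (simp add: v_def)
  qed
  moreover have "blinfun_apply (Blinfun (\<lambda>v. - 2 * p v)) v = - 2 * p v" for v
    by (rule fun_cong[OF bounded_linear_Blinfun_apply[OF blp]])
  ultimately have "Blinfun (\<lambda>v. - 2 * p v) \<in> subgradients K R x"
    unfolding subgradients_def by auto
  then show ?thesis using x(1) by blast
qed

section \<open>Existence of the minimizers that define the predictions\<close>

lemma strongly_convex_onD:
  assumes "strongly_convex_on lam K f" "x \<in> K" "y \<in> K" "g \<in> subgradients K f x"
  shows "f y \<ge> f x + blinfun_apply g (y - x) + lam / 2 * (norm (x - y))\<^sup>2"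
  using assms unfolding strongly_convex_on_def by blast

text \<open>One subgradient \<open>g\<close> at one point \<open>x0\<close> suffices: by strong
  convexity, \<open>R + h\<close> grows quadratically away from \<open>x0\<close>, so its sublevel
  set there has radius at most \<open>2 * norm (g + h) / lam\<close>.\<close>

lemma strongly_convex_linear_attains_inf:
  fixes K :: "'a::real_normed_vector set"
  assumes fd: "\<exists>B :: 'a set. finite_dimensional_vector_space (*\<^sub>R) B"
    and K: "closed K" "K \<noteq> {}" and lam: "lam > 0" and nonneg: "\<And>x. x \<in> K \<Longrightarrow> 0 \<le> R x"
    and lsc: "lower_semicontinuous_on K R" and sc: "strongly_convex_on lam K R"
  shows "\<exists>x\<in>K. \<forall>y\<in>K. R x + blinfun_apply h x \<le> R y + blinfun_apply h y"
proof -
  have "convex_on K R" using sc by (simp add: strongly_convex_on_def)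
  then obtain x0 g where x0: "x0 \<in> K" and g: "g \<in> subgradients K R x0"
    using convex_subgradient_exists[OF fd K _ nonneg lsc] by blast
  have "norm (x - x0) \<le> 2 * norm (g + h) / lam"
    if x: "x \<in> K" and le: "R x + h x \<le> R x0 + h x0" for x
  proof -
    have "lam / 2 * (norm (x - x0))\<^sup>2 \<le> - (g + h) (x - x0)"
      using strongly_convex_onD[OF sc x0 x g] le
      by (simp add: blinfun.add_left blinfun.diff_left blinfun.minus_left blinfun.diff_right
          norm_minus_commute)
    also have "\<dots> \<le> norm (g + h) * norm (x - x0)"
      using norm_blinfun[of "g + h" "x - x0"] by simp
    finally have "norm (x - x0) * (lam / 2 * norm (x - x0)) \<le> norm (x - x0) * norm (g + h)"
      by (simp add: power2_eq_square algebra_simps)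
    then have "norm (x - x0) = 0 \<or> lam / 2 * norm (x - x0) \<le> norm (g + h)"
      unfolding mult_le_cancel_left by auto
    then show ?thesis using lam by (auto simp: field_simps)
  qed
  moreover have "continuous_on K (blinfun_apply h)"
    by (intro continuous_intros)
  ultimately show ?thesis
    using coercive_attains_inf[OF fd K(1) x0 lower_semicontinuous_on_add_continuous[OF lsc]]
    by blast
qed

lemma arg_min_on_attained:
  fixes f :: "'a \<Rightarrow> 'b::linorder"
  assumes "\<exists>x\<in>K. \<forall>y\<in>K. f x \<le> f y"
  shows "arg_min_on f K \<in> K" "y \<in> K \<Longrightarrow> f (arg_min_on f K) \<le> f y"
proof -
  have "is_arg_min f (\<lambda>x. x \<in> K) (arg_min_on f K)"
    unfolding arg_min_on_def arg_min_def
    by (rule someI_ex) (use assms in \<open>auto simp: is_arg_min_linorder\<close>)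
  then show "arg_min_on f K \<in> K" "y \<in> K \<Longrightarrow> f (arg_min_on f K) \<le> f y"
    by (auto simp: is_arg_min_linorder)
qed

section \<open>Cumulative losses\<close>

lemma sum_sq_norms_nonneg: "sum_sq_norms \<l> n \<ge> 0"
  unfolding sum_sq_norms_def by (rule sum_nonneg) simp

lemma sum_sq_norms_Suc: "sum_sq_norms \<l> (Suc n) = sum_sq_norms \<l> n + (norm (\<l> (Suc n)))\<^sup>2"
  unfolding sum_sq_norms_def by simp

lemma norm_cumulative_loss_le:
  "norm (cumulative_loss \<l> n) \<le> sqrt (real n) * sqrt (sum_sq_norms \<l> n)"
proof -
  have "norm (cumulative_loss \<l> n) \<le> (\<Sum>s=1..n. norm (\<l> s))"
    unfolding cumulative_loss_def by (rule norm_sum)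
  also have "\<dots> \<le> sqrt (real n * sum_sq_norms \<l> n)"
    using sum_squared_le_sum_of_squares[of "\<lambda>s. norm (\<l> s)" "{1..n}"]
    by (intro real_le_rsqrt) (simp add: sum_sq_norms_def mult.commute)
  finally show ?thesis by (simp add: real_sqrt_mult)
qed

text \<open>When no loss has been seen, division by zero yields the subgradient \<open>0\<close>, which matches
  the tie-breaking rule.\<close>

lemma solo_ftrl_subgradient:
  fixes K :: "'a::real_normed_vector set"
  assumes fd: "\<exists>B :: 'a set. finite_dimensional_vector_space (*\<^sub>R) B"
    and K: "closed K" "K \<noteq> {}" and lam: "lam > 0" and nonneg: "\<And>x. x \<in> K \<Longrightarrow> 0 \<le> R x"
    and lsc: "lower_semicontinuous_on K R" and sc: "strongly_convex_on lam K R"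
  shows "solo_ftrl K R \<l> (Suc n) \<in> K"
    and "- (cumulative_loss \<l> n /\<^sub>R sqrt (sum_sq_norms \<l> n))
           \<in> subgradients K R (solo_ftrl K R \<l> (Suc n))"
proof -
  define L S where "L = cumulative_loss \<l> n" and "S = sqrt (sum_sq_norms \<l> n)"
  define w where "w = solo_ftrl K R \<l> (Suc n)"
  note min = strongly_convex_linear_attains_inf[OF fd K lam nonneg lsc sc]
  have "w \<in> K \<and> - (L /\<^sub>R S) \<in> subgradients K R w"
  proof (cases "S = 0")
    case True
    then have w: "w = arg_min_on R K" by (simp add: w_def S_def solo_ftrl_def)
    have "\<exists>x\<in>K. \<forall>y\<in>K. R x \<le> R y" using min[of 0] by simp
    from arg_min_on_attained[OF this] show ?thesis
      using True by (simp add: w subgradients_def)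
  next
    case False
    then have S: "S > 0" using sum_sq_norms_nonneg[of \<l> n] by (simp add: S_def)
    define f where "f = (\<lambda>w. blinfun_apply L w + R w * S)"
    \<comment> \<open>Dividing the objective by \<open>S\<close> leaves \<open>R\<close> plus a
      linear functional, so its minimality at \<open>w\<close> says that
      \<open>- (L /\<^sub>R S)\<close> is a subgradient of \<open>R\<close>.\<close>
    have feq: "f x = S * (R x + (L /\<^sub>R S) x)" for x
      using S by (simp add: f_def blinfun.scaleR_left field_simps)
    have w: "w = arg_min_on f K"
      using False by (simp add: w_def S_def solo_ftrl_def f_def L_def)
    have "\<exists>x\<in>K. \<forall>y\<in>K. f x \<le> f y" using min[of "L /\<^sub>R S"] S by (simp add: feq)
    from arg_min_on_attained[OF this] have "w \<in> K" and "\<And>y. y \<in> K \<Longrightarrow> f w \<le> f y"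
      unfolding w by blast+
    then have "\<And>y. y \<in> K \<Longrightarrow> R w + (L /\<^sub>R S) w \<le> R y + (L /\<^sub>R S) y"
      using S unfolding feq by simp
    then show ?thesis
      using \<open>w \<in> K\<close>
      by (auto simp: subgradients_def blinfun.minus_left blinfun.diff_right algebra_simps)
  qed
  then show "solo_ftrl K R \<l> (Suc n) \<in> K"
    and "- (cumulative_loss \<l> n /\<^sub>R sqrt (sum_sq_norms \<l> n))
           \<in> subgradients K R (solo_ftrl K R \<l> (Suc n))"
    by (simp_all add: w_def L_def S_def)
qed

text \<open>Adding the strong convexity inequalities at \<open>x\<close> and at \<open>y\<close>
  gives \<open>lam * (norm (x - y))\<^sup>2 \<le> (g - h) (x - y)\<close>.\<close>

lemma subgradients_lipschitz:
  assumes lam: "lam > 0" and sc: "strongly_convex_on lam K f"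
    and x: "x \<in> K" "g \<in> subgradients K f x" and y: "y \<in> K" "h \<in> subgradients K f y"
  shows "norm (x - y) \<le> norm (g - h) / lam"
proof -
  have "norm (x - y) * (lam * norm (x - y)) \<le> (g - h) (x - y)"
    using strongly_convex_onD[OF sc x(1) y(1) x(2)] strongly_convex_onD[OF sc y(1) x(1) y(2)]
    by (simp add: blinfun.add_left blinfun.diff_left blinfun.minus_left blinfun.diff_right norm_minus_commute power2_eq_square algebra_simps)
  also have "\<dots> \<le> norm (x - y) * norm (g - h)"
    using norm_blinfun[of "g - h" "x - y"] by (simp add: mult.commute)
  finally have "norm (x - y) = 0 \<or> lam * norm (x - y) \<le> norm (g - h)"
    unfolding mult_le_cancel_left by auto
  then show ?thesis using lam by (auto simp: field_simps)
qed

section \<open>The regret bound\<close>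

text \<open>Completing the square in \<open>d\<close>. Below, \<open>a\<close> is the norm of a loss
  and \<open>d\<close> the distance of two predictions.\<close>

lemma linear_le_quadratic_gap:
  fixes a d lam s :: real
  assumes "lam > 0" "s > 0"
  shows "a * d - lam * s / 2 * d\<^sup>2 \<le> a\<^sup>2 / (2 * lam * s)"
proof -
  have "0 \<le> (a - lam * s * d)\<^sup>2 / (2 * lam * s)"
    using assms by simp
  also have "\<dots> = a\<^sup>2 / (2 * lam * s) - (a * d - lam * s / 2 * d\<^sup>2)"
    using assms by (simp add: field_simps power2_eq_square)
  finally show ?thesis by simp
qed

text \<open>Multiplying the subgradient inequality by \<open>s\<close> recovers minimality of the
  objective; for \<open>s = 0\<close> both sides vanish.\<close>

lemma scaled_subgradient_minimizes:
  assumes "- (L /\<^sub>R s) \<in> subgradients K R w" "s \<ge> 0" "s = 0 \<Longrightarrow> L = 0" "y \<in> K"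
  shows "blinfun_apply L w + s * R w \<le> blinfun_apply L y + s * R y"
proof (cases "s = 0")
  case True
  then show ?thesis using assms(3) by simp
next
  case False
  then have s: "s > 0" using assms(2) by simp
  have "R w - (L y - L w) / s \<le> R y"
    using assms(1,4) unfolding subgradients_def
    by (auto simp: blinfun.minus_left blinfun.scaleR_left blinfun.diff_right divide_inverse algebra_simps)
  then show ?thesis using s by (simp add: field_simps)
qed

section \<open>A single round: \<open>w\<close>, \<open>s\<close> before and \<open>w'\<close>,
  \<open>s'\<close> after the loss \<open>\<l>\<close>\<close>

context
  fixes K :: "'a::real_normed_vector set" and R :: "'a \<Rightarrow> real" and lam s s' :: real
    and w w' :: 'a and L \<l> :: "'a \<Rightarrow>\<^sub>L real"
  assumes lam: "lam > 0" and nonneg: "\<And>x. x \<in> K \<Longrightarrow> 0 \<le> R x" and sc: "strongly_convex_on lam K R"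
    and w: "w \<in> K" "- (L /\<^sub>R s) \<in> subgradients K R w"
    and w': "w' \<in> K" "- ((L + \<l>) /\<^sub>R s') \<in> subgradients K R w'"
    and s: "s \<ge> 0" "s = 0 \<Longrightarrow> L = 0" and s': "s' = sqrt (s\<^sup>2 + (norm \<l>)\<^sup>2)"
begin

lemma ftrl_scale_facts: "s \<le> s'" "(norm \<l>)\<^sup>2 = (s' - s) * (s' + s)"
proof -
  show "s \<le> s'" unfolding s' by (rule real_le_rsqrt) simp
  have "s'\<^sup>2 = s\<^sup>2 + (norm \<l>)\<^sup>2" unfolding s' by simp
  then show "(norm \<l>)\<^sup>2 = (s' - s) * (s' + s)"
    by (simp add: power2_eq_square algebra_simps)
qed

text \<open>Strong convexity at \<open>w\<close>, scaled by \<open>s\<close>, supplies the negative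
  square. Passing from \<open>s * R w'\<close> to \<open>s' * R w'\<close> costs nothing because
  \<open>R\<close> is non-negative.\<close>

lemma ftrl_gap_quadratic:
  "(L w + s * R w) + \<l> w - ((L + \<l>) w' + s' * R w')
     \<le> norm \<l> * norm (w - w') - lam * s / 2 * (norm (w - w'))\<^sup>2"
proof -
  have "(L w + s * R w) + lam * s / 2 * (norm (w - w'))\<^sup>2 \<le> L w' + s * R w'"
  proof (cases "s = 0")
    case True
    then show ?thesis using s(2) by simp
  next
    case False
    then have "s > 0" using s(1) by simp
    moreover have "blinfun_apply (- (L /\<^sub>R s)) (w' - w) = - ((L w' - L w) / s)"
      by (simp add: blinfun.minus_left blinfun.scaleR_left blinfun.diff_right divide_inverse
          left_diff_distrib mult.commute[of "inverse s"])
    then have "R w - (L w' - L w) / s + lam / 2 * (norm (w - w'))\<^sup>2 \<le> R w'"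
      using strongly_convex_onD[OF sc w(1) w'(1) w(2)] by linarith
    then have "s * (R w - (L w' - L w) / s + lam / 2 * (norm (w - w'))\<^sup>2) \<le> s * R w'"
      using s(1) by (rule mult_left_mono)
    ultimately show ?thesis
      by (simp add: distrib_left right_diff_distrib[of s "R w"] mult.commute[of lam] mult.assoc)
  qed
  moreover have "\<l> w - \<l> w' \<le> norm \<l> * norm (w - w')"
    using norm_blinfun[of \<l> "w - w'"] by (simp add: blinfun.diff_right)
  moreover have "s * R w' \<le> s' * R w'"
    using ftrl_scale_facts(1) nonneg[OF w'(1)] by (rule mult_right_mono)
  ultimately show ?thesis by (simp add: blinfun.add_left)
qed

lemma ftrl_gap_distance:
  "(L w + s * R w) + \<l> w - ((L + \<l>) w' + s' * R w') \<le> norm \<l> * norm (w - w')"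
proof -
  have "0 \<le> lam * s / 2 * (norm (w - w'))\<^sup>2" using lam s(1) by simp
  then show ?thesis using ftrl_gap_quadratic by linarith
qed

text \<open>The quadratic bound is at most \<open>(norm \<l>)\<^sup>2 / (2 * lam * s)\<close>, and
  the squared norm factors into \<open>s' - s\<close>, which telescopes over the rounds, and
  \<open>s' + s\<close>, which is comparable to \<open>s\<close>.\<close>

lemma ftrl_gap_small_loss:
  assumes "norm \<l> \<le> 2 * s"
  shows "(L w + s * R w) + \<l> w - ((L + \<l>) w' + s' * R w') \<le> 2 / lam * (s' - s)"
proof (cases "s = 0")
  case True
  then have "norm \<l> = 0" using assms by simp
  then have "norm \<l> * norm (w - w') \<le> 2 / lam * (s' - s)"
    using ftrl_scale_facts(1) lam by simp
  then show ?thesis using ftrl_gap_distance by linarith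
next
  case False
  then have spos: "s > 0" using s(1) by simp
  have "(norm \<l>)\<^sup>2 \<le> 4 * s\<^sup>2"
    using power_mono[OF assms norm_ge_zero, of 2] by (simp add: power_mult_distrib)
  \<comment> \<open>The factor 5 would do; 9 is a perfect square and gives
    \<open>s' + s \<le> 4 * s\<close>, hence the constant 2.\<close>
  then have "s\<^sup>2 + (norm \<l>)\<^sup>2 \<le> 9 * s\<^sup>2"
    using zero_le_power2[of s] by linarith
  then have "s' \<le> 3 * s"
    unfolding s' using s(1) by (intro real_le_lsqrt) (auto simp: power_mult_distrib)
  then have "(norm \<l>)\<^sup>2 \<le> (s' - s) * (4 * s)"
    unfolding ftrl_scale_facts(2) using ftrl_scale_facts(1) by (intro mult_left_mono) auto
  then have "(norm \<l>)\<^sup>2 / (2 * lam * s) \<le> (s' - s) * (4 * s) / (2 * lam * s)"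
    using lam spos by (intro divide_right_mono) auto
  also have "\<dots> = 2 / lam * (s' - s)"
    using lam spos by (simp add: field_simps)
  finally show ?thesis
    using ftrl_gap_quadratic linear_le_quadratic_gap[OF lam spos, of "norm \<l>" "norm (w - w')"]
    by linarith
qed

text \<open>The Lipschitz bound on the distance of the predictions gives
  \<open>norm (w - w') \<le> (r + norm \<l> / s') / lam\<close> when \<open>s > 0\<close>. The
  estimate holds for losses of any size.\<close>

lemma ftrl_gap_large_loss:
  assumes L: "norm L \<le> r * s" and r: "r \<ge> 0"
  shows "(L w + s * R w) + \<l> w - ((L + \<l>) w' + s' * R w')
           \<le> r / lam * norm \<l> + 2 / lam * (s' - s)"
proof (cases "s' = 0")
  case True
  then have "s = 0" using ftrl_scale_facts(1) s(1) by simp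
  with True have "norm \<l> = 0" using ftrl_scale_facts(2) by simp
  with \<open>s = 0\<close> show ?thesis using ftrl_gap_small_loss by simp
next
  case False
  then have s'pos: "s' > 0" using ftrl_scale_facts(1) s(1) by simp
  show ?thesis
  proof (cases "s = 0")
    case True
    have s'eq: "s' = norm \<l>" unfolding s' True by simp
    \<comment> \<open>For \<open>s = 0\<close> the square in the quadratic bound vanishes. Here
      \<open>w\<close> minimizes \<open>R\<close>, so \<open>s' * R w'\<close> itself supplies a
      square with factor \<open>s'\<close>.\<close>
    have "R w + lam / 2 * (norm (w - w'))\<^sup>2 \<le> R w'"
      using strongly_convex_onD[OF sc w(1) w'(1) w(2)] True by simp
    then have "lam / 2 * (norm (w - w'))\<^sup>2 \<le> R w'"
      using nonneg[OF w(1)] by linarith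
    then have "s' * (lam / 2 * (norm (w - w'))\<^sup>2) \<le> s' * R w'"
      using s'pos by simp
    moreover have "\<l> w - \<l> w' \<le> norm \<l> * norm (w - w')"
      using norm_blinfun[of \<l> "w - w'"] by (simp add: blinfun.diff_right)
    ultimately have "(L w + s * R w) + \<l> w - ((L + \<l>) w' + s' * R w')
        \<le> norm \<l> * norm (w - w') - lam * s' / 2 * (norm (w - w'))\<^sup>2"
      using s(2)[OF True] True by (simp add: algebra_simps)
    also have "\<dots> \<le> (norm \<l>)\<^sup>2 / (2 * lam * s')"
      by (rule linear_le_quadratic_gap[OF lam s'pos])
    also have "\<dots> = s' / (2 * lam)"
      using s'pos unfolding s'eq by (simp add: power2_eq_square field_simps)
    also have "\<dots> \<le> 2 / lam * (s' - s)"
      using lam s'pos True by (simp add: field_simps)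
    also have "\<dots> \<le> r / lam * norm \<l> + 2 / lam * (s' - s)"
      using lam r by simp
    finally show ?thesis .
  next
    case False
    then have spos: "s > 0" using s(1) by simp
    \<comment> \<open>The first summand comes from rescaling the old losses and has norm at most
      \<open>r\<close>, the second from the new loss.\<close>
    have eq: "- (L /\<^sub>R s) - - ((L + \<l>) /\<^sub>R s') = (s / s' - 1) *\<^sub>R (L /\<^sub>R s) + \<l> /\<^sub>R s'"
      using spos s'pos by (simp add: algebra_simps divide_inverse)
    have "norm ((s / s' - 1) *\<^sub>R (L /\<^sub>R s)) \<le> 1 * r"
      unfolding norm_scaleR
    proof (rule mult_mono)
      show "\<bar>s / s' - 1\<bar> \<le> 1"
        using ftrl_scale_facts(1) spos s'pos by (simp add: abs_le_iff field_simps)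
      show "\<bar>inverse s\<bar> * norm L \<le> r"
        using L spos by (simp add: field_simps)
    qed (use r in auto)
    moreover have "norm (\<l> /\<^sub>R s') = norm \<l> / s'"
      using s'pos by (simp add: divide_inverse mult.commute)
    ultimately have "norm (- (L /\<^sub>R s) - - ((L + \<l>) /\<^sub>R s')) \<le> r + norm \<l> / s'"
      unfolding eq using norm_triangle_ineq[of "(s / s' - 1) *\<^sub>R (L /\<^sub>R s)" "\<l> /\<^sub>R s'"]
      by linarith
    then have "norm (w - w') \<le> (r + norm \<l> / s') / lam"
      using order_trans[OF subgradients_lipschitz[OF lam sc w w'] divide_right_mono] lam by simp
    then have "norm \<l> * norm (w - w') \<le> norm \<l> * ((r + norm \<l> / s') / lam)"
      by (rule mult_left_mono) simp
    moreover have "norm \<l> * ((r + norm \<l> / s') / lam)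
        = r / lam * norm \<l> + (norm \<l>)\<^sup>2 / (lam * s')"
      using s'pos lam by (simp add: field_simps power2_eq_square)
    moreover have "(norm \<l>)\<^sup>2 / (lam * s') \<le> 2 / lam * (s' - s)"
    proof -
      have "(norm \<l>)\<^sup>2 \<le> (s' - s) * (2 * s')"
        unfolding ftrl_scale_facts(2) using ftrl_scale_facts(1) by (intro mult_left_mono) auto
      then have "(norm \<l>)\<^sup>2 / (lam * s') \<le> (s' - s) * (2 * s') / (lam * s')"
        using lam s'pos by (intro divide_right_mono) auto
      then show ?thesis using lam s'pos by (simp add: field_simps)
    qed
    ultimately have "norm \<l> * norm (w - w') \<le> r / lam * norm \<l> + 2 / lam * (s' - s)"
      by linarith
    then show ?thesis using ftrl_gap_distance by linarith
  qed
qed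

end

text \<open>Indices with \<open>a n > 2 * S n\<close> carry at least twice the norm of all earlier terms, so the
  corresponding \<open>a n\<close> sum to at most twice their maximum.\<close>

lemma sum_gaps_le:
  fixes a S \<delta> :: "nat \<Rightarrow> real" and C k :: real
  assumes a: "\<And>n. 0 \<le> a n" and S: "\<And>n. S n = sqrt (\<Sum>i<n. (a i)\<^sup>2)" and C: "C \<ge> 0"
    and small: "\<And>n. n < T \<Longrightarrow> a n \<le> 2 * S n \<Longrightarrow> \<delta> n \<le> k * (S (Suc n) - S n)"
    and step: "\<And>n. n < T \<Longrightarrow> \<delta> n \<le> C * a n + k * (S (Suc n) - S n)"
  shows "N \<le> T \<Longrightarrow> 0 \<le> M \<Longrightarrow> (\<And>n. n < N \<Longrightarrow> a n \<le> M) \<Longrightarrow> (\<Sum>n<N. \<delta> n) \<le> k * S N + 2 * C * M"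
proof (induction N arbitrary: M)
  case 0
  then show ?case using C by (simp add: S)
next
  case (Suc N)
  show ?case
  proof (cases "a N \<le> 2 * S N")
    case True
    have "(\<Sum>n<N. \<delta> n) \<le> k * S N + 2 * C * M"
      using Suc by simp
    then show ?thesis
      using small[of N] True Suc.prems(1) by (simp add: algebra_simps)
  next
    case False
    have "a n \<le> a N / 2" if "n < N" for n
    proof -
      have "(a n)\<^sup>2 \<le> (\<Sum>i<N. (a i)\<^sup>2)"
        using that by (intro member_le_sum) auto
      then have "a n \<le> S N" unfolding S by (rule real_le_rsqrt)
      then show ?thesis using False by simp
    qed
    \<comment> \<open>The induction hypothesis is used with the halved bound \<open>a N / 2\<close>:
      the past costs \<open>C * a N\<close>, the current term as much again.\<close>
    then have "(\<Sum>n<N. \<delta> n) \<le> k * S N + 2 * C * (a N / 2)"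
      using Suc.IH[of "a N / 2"] Suc.prems(1) a[of N] by simp
    moreover have "\<delta> N \<le> C * a N + k * (S (Suc N) - S N)"
      using step Suc.prems(1) by simp
    moreover have "C * a N \<le> C * M"
      using Suc.prems(3)[of N] C by (intro mult_left_mono) auto
    ultimately show ?thesis by (simp add: algebra_simps)
  qed
qed

theorem theorem2:
  fixes K :: "'a::real_normed_vector set"
    and R :: "'a \<Rightarrow> real"
    and lam :: real
    and \<l> :: "nat \<Rightarrow> ('a \<Rightarrow>\<^sub>L real)"
    and T :: nat
    and u :: 'a
  assumes "\<exists>B :: 'a set. finite_dimensional_vector_space (*\<^sub>R) B"
    and "K \<noteq> {}" and "closed K" and "convex K"
    and "lam > 0"
    and "\<forall>x\<in>K. R x \<ge> 0"
    and "lower_semicontinuous_on K R"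
    and "strongly_convex_on lam K R"
    and "T \<ge> 1"
    and "u \<in> K"
  shows "ereal (regret \<l> (solo_ftrl K R \<l>) T u)
         \<le> ereal ((R u + 2.75 / lam) * sqrt (\<Sum>t=1..T. (norm (\<l> t))\<^sup>2))
           + ereal 3.5 * min (ereal (sqrt (real T - 1) / lam)) (ediameter K)
             * ereal (MAX t\<in>{1..T}. norm (\<l> t))"
proof -
  have nonneg: "\<And>x. x \<in> K \<Longrightarrow> 0 \<le> R x" using assms(6) by blast
  define L where "L = cumulative_loss \<l>"
  \<comment> \<open>The index \<open>n\<close> counts the losses already seen: \<open>W n\<close> is
    the prediction of round \<open>n + 1\<close> and \<open>a n\<close> the norm of that round's
    loss.\<close>
  define S where "S = (\<lambda>n. sqrt (sum_sq_norms \<l> n))"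
  define W where "W = (\<lambda>n. solo_ftrl K R \<l> (Suc n))"
  define a where "a = (\<lambda>n. norm (\<l> (Suc n)))"
  define F where "F = (\<lambda>n. L n (W n) + S n * R (W n))"
  define \<delta> where "\<delta> = (\<lambda>n. F n + \<l> (Suc n) (W n) - F (Suc n))"
  define M where "M = (MAX t\<in>{1..T}. norm (\<l> t))"
  have W: "W n \<in> K" "- (L n /\<^sub>R S n) \<in> subgradients K R (W n)" for n
    unfolding W_def L_def S_def
    using solo_ftrl_subgradient[OF assms(1,3,2,5) nonneg assms(7,8)] by blast+
  have S_nonneg: "S n \<ge> 0" for n
    using sum_sq_norms_nonneg by (simp add: S_def)
  have L_bound: "norm (L n) \<le> sqrt (real n) * S n" for n
    unfolding L_def S_def by (rule norm_cumulative_loss_le)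
  have L_zero: "L n = 0" if "S n = 0" for n
    using L_bound[of n] that by simp
  have L_Suc: "L (Suc n) = L n + \<l> (Suc n)" for n
    by (simp add: L_def cumulative_loss_def)
  have S_Suc: "S (Suc n) = sqrt ((S n)\<^sup>2 + (norm (\<l> (Suc n)))\<^sup>2)" for n
    using sum_sq_norms_nonneg[of \<l> n] by (simp add: S_def sum_sq_norms_Suc)
  have gap_distance: "\<delta> n \<le> a n * norm (W n - W (Suc n))"
    and small: "a n \<le> 2 * S n \<Longrightarrow> \<delta> n \<le> 2 / lam * (S (Suc n) - S n)"
    and large: "norm (L n) \<le> r * S n \<Longrightarrow> 0 \<le> r
      \<Longrightarrow> \<delta> n \<le> r / lam * a n + 2 / lam * (S (Suc n) - S n)"
    and S_mono: "S n \<le> S (Suc n)" for n r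
  proof -
    have \<delta>: "\<delta> n = (L n (W n) + S n * R (W n)) + \<l> (Suc n) (W n)
        - ((L n + \<l> (Suc n)) (W (Suc n)) + S (Suc n) * R (W (Suc n)))"
      by (simp add: \<delta>_def F_def L_Suc)
    note gap = assms(5) nonneg assms(8) W[of n] W[of "Suc n", unfolded L_Suc]
      S_nonneg[of n] L_zero[of n] S_Suc[of n]
    show "\<delta> n \<le> a n * norm (W n - W (Suc n))"
      unfolding \<delta> a_def by (rule ftrl_gap_distance[OF gap])
    show "\<delta> n \<le> 2 / lam * (S (Suc n) - S n)" if "a n \<le> 2 * S n"
      unfolding \<delta> a_def
      by (rule ftrl_gap_small_loss[OF gap]) (use that in \<open>simp_all add: a_def\<close>)
    show "\<delta> n \<le> r / lam * a n + 2 / lam * (S (Suc n) - S n)"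
      if "norm (L n) \<le> r * S n" "0 \<le> r"
      unfolding \<delta> a_def
      by (rule ftrl_gap_large_loss[OF gap]) (use that in \<open>simp_all add: a_def\<close>)
    show "S n \<le> S (Suc n)"
      by (rule ftrl_scale_facts(1)[OF gap])
  qed
  have M: "norm (\<l> t) \<le> M" if "t \<in> {1..T}" for t
    unfolding M_def using that by (intro Max_ge) auto
  have M_nonneg: "M \<ge> 0"
    using order_trans[OF norm_ge_zero M[of 1]] assms(9) by simp
  have diam: "ereal (norm (x - y)) \<le> ediameter K" if "x \<in> K" "y \<in> K" for x y
    unfolding ediameter_def using that by (intro SUP_upper2[of "(x, y)"]) auto
  have diam_nonneg: "0 \<le> ediameter K"
    using diam[OF assms(10,10)] by (simp add: zero_ereal_def)
  \<comment> \<open>The minimum is a real number even if the diameter is infinite, so the remaining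
    argument takes place in the reals.\<close>
  obtain C where C: "C \<ge> 0" "ereal C = min (ereal (sqrt (real T - 1) / lam)) (ediameter K)"
    and step: "\<And>n. n < T \<Longrightarrow> \<delta> n \<le> C * a n + 2 / lam * (S (Suc n) - S n)"
  proof (cases "ereal (sqrt (real T - 1) / lam) \<le> ediameter K")
    case True
    show ?thesis
    proof (rule that)
      show "0 \<le> sqrt (real T - 1) / lam" using assms(5,9) by simp
      show "ereal (sqrt (real T - 1) / lam) = min (ereal (sqrt (real T - 1) / lam)) (ediameter K)"
        using True by simp
      fix n assume n: "n < T"
      \<comment> \<open>At most \<open>T - 1\<close> losses precede any of the rounds up to
        \<open>T\<close>.\<close>
      have "norm (L n) \<le> sqrt (real T - 1) * S n"
        by (rule order_trans[OF L_bound mult_right_mono]) (use n S_nonneg in auto)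
      then show "\<delta> n \<le> sqrt (real T - 1) / lam * a n + 2 / lam * (S (Suc n) - S n)"
        by (rule large) (use assms(9) in simp)
    qed
  next
    case False
    then obtain D where D: "ediameter K = ereal D"
      using diam_nonneg by (cases "ediameter K") auto
    show ?thesis
    proof (rule that)
      show "0 \<le> D" using diam_nonneg by (simp add: D)
      show "ereal D = min (ereal (sqrt (real T - 1) / lam)) (ediameter K)"
        using False by (simp add: D min_def)
      fix n
      note gap_distance[of n]
      also have "a n * norm (W n - W (Suc n)) \<le> a n * D"
        using diam[OF W(1) W(1), of n "Suc n"] by (intro mult_left_mono) (simp_all add: D a_def)
      finally show "\<delta> n \<le> D * a n + 2 / lam * (S (Suc n) - S n)"
        using S_mono[of n] assms(5) by (simp add: mult.commute add_increasing2)
    qed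
  qed
  have S_eq: "S n = sqrt (\<Sum>i<n. (a i)\<^sup>2)" for n
    by (simp add: S_def sum_sq_norms_def a_def sum.atLeast1_atMost_eq)
  have gaps: "(\<Sum>n<T. \<delta> n) \<le> 2 / lam * S T + 2 * C * M"
    by (rule sum_gaps_le[OF _ S_eq C(1) _ step])
      (use small M M_nonneg in \<open>auto simp: a_def\<close>)
  \<comment> \<open>The comparator enters only here, through the minimality of \<open>W T\<close>,
    the prediction for round \<open>T + 1\<close>.\<close>
  have "F T \<le> L T u + S T * R u"
    unfolding F_def by (rule scaled_subgradient_minimizes[OF W(2) S_nonneg L_zero assms(10)])
  moreover have "(\<Sum>n<T. \<delta> n) = (\<Sum>n<T. \<l> (Suc n) (W n)) + (\<Sum>n<T. F n - F (Suc n))"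
    unfolding \<delta>_def sum.distrib[symmetric] by (simp add: algebra_simps)
  moreover have "(\<Sum>n<T. F n - F (Suc n)) = F 0 - F T"
    by (rule sum_lessThan_telescope')
  moreover have "F 0 = 0"
    by (simp add: F_def S_def L_def cumulative_loss_def sum_sq_norms_def)
  moreover have "regret \<l> (solo_ftrl K R \<l>) T u = (\<Sum>n<T. \<l> (Suc n) (W n)) - L T u"
    by (simp add: regret_def W_def L_def cumulative_loss_def sum.atLeast1_atMost_eq
        blinfun.sum_left)
  ultimately have "regret \<l> (solo_ftrl K R \<l>) T u \<le> S T * R u + 2 / lam * S T + 2 * C * M"
    using gaps by linarith
  \<comment> \<open>The argument yields the constant 2 in both places, which is below 2.75 and
    3.5.\<close>
  also have "\<dots> \<le> (R u + 2.75 / lam) * S T + 3.5 * C * M"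
  proof -
    have "2 / lam * S T \<le> 2.75 / lam * S T"
      using S_nonneg[of T] assms(5) by (intro mult_right_mono divide_right_mono) auto
    moreover have "2 * (C * M) \<le> 3.5 * (C * M)"
      using C(1) M_nonneg by simp
    ultimately show ?thesis by (simp add: algebra_simps)
  qed
  finally show ?thesis
    unfolding C(2)[symmetric] M_def[symmetric] by (simp add: S_def sum_sq_norms_def)
qed

end
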